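(* Let $S$ be a random walk with state space $\mathcal Z\subset\mathbb R^d$, $d\ge1$. Put $\tau_\pm:=\inf\{n\ge1:S_n\in\pm(0,\infty)^d\}$ and assume that $\mathbb P_0(\tau_+<\infty)=1$ and $\mathbb P_0(\tau_-<\infty)=1$. Then the measures $$\pi_+(dx):=(1-\mathbb P(X_1\le x))\,\lambda(dx),\quad x\in\mathcal Z\cap[0,\infty)^d,$$ and $$\pi_-(dx):=(1-\mathbb P(X_1>x))\,\lambda(dx),\quad x\in\mathcal Z\cap(-\infty,0)^d,$$ are invariant for the chains of entrances of $S$ into $[0,\infty)^d$ and $(-\infty,0)^d$, respectively. Moreover, for $d=1$, the measure $$\pi(dx):=\bigl[\mathbf 1_{[0,\infty)}(x)\,\mathbb P(X_1>x)+\mathbf 1_{(-\infty,0)}(x)\,\mathbb P(X_1\le x)\bigr]\lambda(dx),\quad x\in\mathcal Z,$$ is invariant for the chain of overshoots $\mathcal O$.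
   Context: Random walk. $S_n=S_0+X_1+\dots+X_n$, where $X_1,X_2,\dots$ are i.i.d. random vectors in $\mathbb R^d$ (non-degenerate) and $S_0$ is independent of them. The state space $\mathcal Z$ is the minimal topologically closed subgroup of $(\mathbb R^d,+)$ containing the topological support of the distribution of $X_1$; it is assumed that $\mathcal Z$ has full dimension and $S_0\in\mathcal Z$. $\mathbb P_x$ denotes the law of the walk with $S_0=x$. $\lambda$ is the normalized Haar measure on $\mathcal Z$ (the normalization is immaterial here). Inequalities between points of $\mathbb R^d$ are understood coordinate-wise. Entrance chain. For a Borel set $B\subset\mathbb R^d$ let $A:=B\cap\mathcal Z$, $A^c:=\mathcal Z\setminus A$. The chain of entrances of $S$ into $B$ is the sequence of values of $S$ at the successive times $k\ge1$ with $S_{k-1}\in A^c$, $S_k\in A$; it is a Markov chain on $A$ (augmented by a cemetery state if there are finitely many such times) whose transition kernel from $x\in A$ is the $\mathbb P_x$-law of the first such value. Overshoots ($d=1$). $\mathcal T_0:=0$, $\mathcal T_n:=\inf\{k>\mathcal T_{n-1}:S_{k-1}<0,S_k\ge0\ \text{or}\ S_{k-1}\ge0,S_k<0\}$ for $n\ge1$, and $\mathcal O_n:=S_{\mathcal T_n}$. $\mathcal O=(\mathcal O_n)_{n\ge1}$ is a Markov chain on $\mathcal Z$ with transition kernel $x\mapsto\mathbb P_x(\mathcal O_1\in\cdot)$. A measure $\nu$ on a Borel set $E\subset\mathcal Z$ is invariant for a chain with kernel $K$ if $\int_E K(x,B)\,\nu(dx)=\nu(B)$ for every Borel $B\subset E$.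 *)

theory Defs
  imports "HOL-Probability.Probability"
begin

(* x <e y is the strict inequality in every coordinate; the class order x < y on
   ordered_euclidean_space only means x \<le> y \<and> x \<noteq> y.  The non-strict x \<le> y is coordinatewise. *)
notation eucl_less (infix "<e" 50)

definition closed_add_subgroup :: "'a::real_normed_vector set \<Rightarrow> bool" where
  "closed_add_subgroup G \<longleftrightarrow>
     closed G \<and> 0 \<in> G \<and> (\<forall>x\<in>G. \<forall>y\<in>G. x + y \<in> G) \<and> (\<forall>x\<in>G. - x \<in> G)"

definition topological_support :: "'a::topological_space measure \<Rightarrow> 'a set" where
  "topological_support \<mu> = {x. \<forall>U. open U \<longrightarrow> x \<in> U \<longrightarrow> emeasure \<mu> U > 0}"

(* The increments are X 1, X 2, ...; the value X 0 is never used. *)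
definition state_space :: "'w measure \<Rightarrow> (nat \<Rightarrow> 'w \<Rightarrow> 'a::euclidean_space) \<Rightarrow> 'a set" where
  "state_space M X = closed_add_subgroup hull topological_support (distr M borel (X 1))"

definition random_walk :: "'w measure \<Rightarrow> (nat \<Rightarrow> 'w \<Rightarrow> 'a::euclidean_space) \<Rightarrow> bool" where
  "random_walk M X \<longleftrightarrow>
     prob_space M \<and>
     prob_space.indep_vars M (\<lambda>_. borel) X {1..} \<and>
     (\<forall>n\<ge>1. distr M borel (X n) = distr M borel (X 1)) \<and>
     \<not> (\<exists>c. AE \<omega> in M. X 1 \<omega> = c) \<and>
     dim (state_space M X) = DIM('a)"

(* The law on path space of the walk started at S_0 = x. *)
definition walk_law ::
    "'w measure \<Rightarrow> (nat \<Rightarrow> 'w \<Rightarrow> 'a::euclidean_space) \<Rightarrow> 'a \<Rightarrow> (nat \<Rightarrow> 'a) measure" where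
  "walk_law M X x =
     distr M (PiM UNIV (\<lambda>_. borel)) (\<lambda>\<omega> n. x + (\<Sum>i=1..n. X i \<omega>))"

(* On the closed subgroup G of a Euclidean space a Borel measure that is finite on compact sets is
   automatically regular, so regularity is not listed. No normalization is imposed. *)
definition haar_measure_on :: "'a::real_normed_vector set \<Rightarrow> 'a measure \<Rightarrow> bool" where
  "haar_measure_on G lam \<longleftrightarrow>
     sets lam = sets (restrict_space borel G) \<and>
     (\<forall>z\<in>G. \<forall>B\<in>sets lam. emeasure lam ((+) z ` B) = emeasure lam B) \<and>
     (\<forall>K. compact K \<longrightarrow> K \<subseteq> G \<longrightarrow> emeasure lam K < \<infinity>) \<and>
     emeasure lam G > 0"

(* event_time Q n is the n-th k \<ge> 1 at which Q holds (infinity if there is none). *)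
fun event_time :: "(nat \<Rightarrow> bool) \<Rightarrow> nat \<Rightarrow> enat" where
  "event_time Q 0 = 0"
| "event_time Q (Suc n) = Inf {enat k | k. enat k > event_time Q n \<and> Q k}"

(* Transition kernel of the chain of values of the walk at the successive event times of Q.
   It is sub-stochastic: mass missing from 1 is the probability of jumping to the cemetery. *)
definition event_kernel ::
    "'w measure \<Rightarrow> (nat \<Rightarrow> 'w \<Rightarrow> 'a::euclidean_space) \<Rightarrow> ((nat \<Rightarrow> 'a) \<Rightarrow> nat \<Rightarrow> bool) \<Rightarrow>
      'a \<Rightarrow> 'a set \<Rightarrow> ennreal" where
  "event_kernel M X Q x C =
     emeasure (walk_law M X x)
       {s \<in> space (walk_law M X x).
          event_time (Q s) 1 < \<infinity> \<and> s (the_enat (event_time (Q s) 1)) \<in> C}"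

definition entrance_kernel ::
    "'w measure \<Rightarrow> (nat \<Rightarrow> 'w \<Rightarrow> 'a::euclidean_space) \<Rightarrow> 'a set \<Rightarrow> 'a \<Rightarrow> 'a set \<Rightarrow> ennreal" where
  "entrance_kernel M X B =
     event_kernel M X
       (\<lambda>s k. s (k - 1) \<in> state_space M X - B \<and> s k \<in> state_space M X \<inter> B)"

(* Meant for DIM('a) = 1, where "0 \<le> x" and "x <e 0" are complementary. *)
definition overshoot_kernel ::
    "'w measure \<Rightarrow> (nat \<Rightarrow> 'w \<Rightarrow> 'a::ordered_euclidean_space) \<Rightarrow> 'a \<Rightarrow> 'a set \<Rightarrow> ennreal" where
  "overshoot_kernel M X =
     event_kernel M X
       (\<lambda>s k. s (k - 1) <e 0 \<and> 0 \<le> s k \<or> 0 \<le> s (k - 1) \<and> s k <e 0)"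

definition invariant_on ::
    "'a::topological_space set \<Rightarrow> ('a \<Rightarrow> 'a set \<Rightarrow> ennreal) \<Rightarrow> 'a measure \<Rightarrow> bool" where
  "invariant_on E K \<nu> \<longleftrightarrow>
     sets \<nu> = sets (restrict_space borel E) \<and>
     (\<forall>C\<in>sets borel. C \<subseteq> E \<longrightarrow> (\<integral>\<^sup>+ x. K x C \<partial>\<nu>) = emeasure \<nu> C)"

end

theory Submission
  imports Defs
begin

text \<open>
  All three measures have the form \<open>P((x - X\<^sub>1, x) \<in> E) \<lambda>(dx)\<close>, and all three chains record the end
  points of the successive edges of the walk lying in a set \<open>E\<close>: for entrances into \<open>B\<close> this is
  \<open>(\<Z> - B) \<times> (\<Z> \<inter> B)\<close>, for overshoots the set of pairs separated by the origin. Let \<open>R\<close> and \<open>Q\<close> be the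
  one-step operators of the walk restricted to edges in \<open>E\<close> and outside \<open>E\<close>, so that the transition kernel is
  \<open>K(\<cdot>, C) = \<Sum>\<^sub>n Q\<^sup>n R 1\<^sub>C\<close>, and let \<open>R'\<close> and \<open>Q'\<close> be the adjoints with respect to \<open>\<lambda>\<close>, which belong to the
  reflected walk along reversed edges. The measure in question is \<open>(R' 1) \<lambda>\<close>, and
  \<open>\<integral> (R' 1) \<Sum>\<^sub>n Q\<^sup>n R 1\<^sub>C d\<lambda> = \<integral> (\<Sum>\<^sub>n Q'\<^sup>n R' 1) R 1\<^sub>C d\<lambda>\<close>. The sum on the right is the probability that the
  reflected walk ever traverses a reversed edge of \<open>E\<close>. If it is \<open>1\<close>, what remains is
  \<open>\<integral> R 1\<^sub>C d\<lambda> = \<integral>\<^sub>C R' 1 d\<lambda>\<close>, which is invariance.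

  That the sum is \<open>1\<close> holds because the walk enters every translate of the two open orthants
  infinitely often: reaching \<open>(0, \<infinity>)\<^sup>d\<close> almost surely implies exceeding some \<open>\<epsilon> (1, \<dots>, 1)\<close>
  almost surely, and by the Markov property this level can be raised indefinitely.
\<close>

section \<open>First passages along edges\<close>

text \<open>The walk as a function of its increments, with \<open>\<omega> i\<close> the step from
  time \<open>i\<close> to time \<open>i + 1\<close>. Walks from all starting points thus live on
  one product space.\<close>

definition walk_path :: "'a::euclidean_space \<Rightarrow> (nat \<Rightarrow> 'a) \<Rightarrow> nat \<Rightarrow> 'a" where
  "walk_path x \<omega> n = x + (\<Sum>i<n. \<omega> i)"

lemma walk_path_0 [simp]: "walk_path x \<omega> 0 = x"
  by (simp add: walk_path_def)

lemma walk_path_Suc: "walk_path x \<omega> (Suc n) = walk_path x \<omega> n + \<omega> n"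
  by (simp add: walk_path_def add.assoc)

lemma walk_path_case_nat [simp]:
  "walk_path x (case_nat v \<omega>) (Suc n) = walk_path (x + v) \<omega> n"
  by (simp add: walk_path_def sum.lessThan_Suc_shift add.assoc del: sum.lessThan_Suc)

text \<open>The index \<open>n\<close> is the starting time of the edge, so the recorded time is
  \<open>Suc n\<close>. The set \<open>C\<close> restricts only the end point: an earlier edge in
  \<open>E\<close> rules the passage out even if it ends outside \<open>C\<close>.\<close>

definition first_passage ::
    "('a::euclidean_space \<times> 'a) set \<Rightarrow> 'a set \<Rightarrow> 'a \<Rightarrow> nat \<Rightarrow> (nat \<Rightarrow> 'a) set" where
  "first_passage E C x n =
     {\<omega>. (walk_path x \<omega> n, walk_path x \<omega> (Suc n)) \<in> E \<and> walk_path x \<omega> (Suc n) \<in> C \<and>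
          (\<forall>j<n. (walk_path x \<omega> j, walk_path x \<omega> (Suc j)) \<notin> E)}"

lemma disjoint_family_first_passage: "disjoint_family (first_passage E C x)"
proof -
  have "m = n" if "\<omega> \<in> first_passage E C x m" "\<omega> \<in> first_passage E C x n" for m n \<omega>
    using that by (cases m n rule: linorder_cases) (auto simp: first_passage_def)
  then show ?thesis
    unfolding disjoint_family_on_def by blast
qed

lemma first_passage_Suc:
  "case_nat v \<omega> \<in> first_passage E C x (Suc n) \<longleftrightarrow>
     (x, x + v) \<notin> E \<and> \<omega> \<in> first_passage E C (x + v) n"
  by (auto simp: first_passage_def less_Suc_eq_0_disj)

text \<open>The least index of an edge in \<open>E\<close> is a first passage, since
  \<open>UNIV\<close> imposes nothing on its end point.\<close>

lemma ex_first_passage_UNIV: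
  "(\<exists>n. \<omega> \<in> first_passage E UNIV x n) \<longleftrightarrow>
     (\<exists>n. (walk_path x \<omega> n, walk_path x \<omega> (Suc n)) \<in> E)"
  (is "?L \<longleftrightarrow> (\<exists>n. ?P n)")
proof
  assume "\<exists>n. ?P n"
  then have "?P (LEAST n. ?P n)" "\<forall>j<(LEAST n. ?P n). \<not> ?P j"
    by (auto intro: LeastI dest: not_less_Least)
  then show ?L
    by (auto simp: first_passage_def)
qed (auto simp: first_passage_def)

lemma converse_measurable [measurable]:
  assumes [measurable]: "E \<in> sets (borel \<Otimes>\<^sub>M borel)"
  shows "E\<inverse> \<in> sets (borel \<Otimes>\<^sub>M borel)"
proof -
  have "E\<inverse> = {p \<in> space (borel \<Otimes>\<^sub>M borel). (snd p, fst p) \<in> E}"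
    by (auto simp: space_pair_measure)
  also have "\<dots> \<in> sets (borel \<Otimes>\<^sub>M borel)"
    by measurable
  finally show ?thesis .
qed

text \<open>In the notation of the overview, \<open>edge_step \<mu> E\<close> is R and
  \<open>edge_step \<mu> (- E)\<close> is Q; R' and Q' arise from the reflected step law and the
  reversed edges.\<close>

definition edge_step ::
    "'a::euclidean_space measure \<Rightarrow> ('a \<times> 'a) set \<Rightarrow> ('a \<Rightarrow> ennreal) \<Rightarrow> 'a \<Rightarrow> ennreal" where
  "edge_step \<mu> E f x = (\<integral>\<^sup>+ v. indicator E (x, x + v) * f (x + v) \<partial>\<mu>)"

text \<open>The step law is a parameter so that the results apply both to the walk and to its
  reflection.\<close>

locale iid_walk = sequence_space \<mu> for \<mu> :: "'a::euclidean_space measure" +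
  assumes sets_steps [simp, measurable_cong]: "sets \<mu> = sets borel"
begin

lemma space_steps [simp]: "space \<mu> = UNIV"
  using sets_eq_imp_space_eq[OF sets_steps] by simp

lemma space_S [simp]: "space S = UNIV"
  by (simp add: space_PiM)

lemma measurable_walk_path [measurable (raw)]:
  assumes [measurable]: "f \<in> borel_measurable N" "g \<in> measurable N S"
  shows "(\<lambda>w. walk_path (f w) (g w) n) \<in> borel_measurable N"
proof -
  have [measurable]: "(\<lambda>w. g w i) \<in> borel_measurable N" for i
  proof -
    have "(\<lambda>w. g w i) \<in> measurable N \<mu>"
      using measurable_compose[OF assms(2) measurable_component_singleton[of i UNIV "\<lambda>_. \<mu>"]] by simp
    then show ?thesis
      by (simp cong: measurable_cong_sets)
  qed
  show ?thesis
    unfolding walk_path_def by measurable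
qed

lemma first_passage_measurable [measurable]:
  assumes [measurable]: "E \<in> sets (borel \<Otimes>\<^sub>M borel)" "C \<in> sets borel"
  shows "first_passage E C x n \<in> sets S"
proof -
  have "{\<omega> \<in> space S. \<omega> \<in> first_passage E C x n} \<in> sets S"
    unfolding first_passage_def mem_Collect_eq by measurable
  then show ?thesis by simp
qed

lemma edge_step_measurable [measurable]:
  assumes [measurable]: "E \<in> sets (borel \<Otimes>\<^sub>M borel)" "f \<in> borel_measurable borel"
  shows "edge_step \<mu> E f \<in> borel_measurable borel"
  unfolding edge_step_def by measurable

lemma edge_step_iterate_measurable [measurable]:
  assumes [measurable]: "E \<in> sets (borel \<Otimes>\<^sub>M borel)" "f \<in> borel_measurable borel"
  shows "(edge_step \<mu> E ^^ n) f \<in> borel_measurable borel"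
  by (induction n) simp_all

text \<open>Prepending an independent step with law \<open>\<mu>\<close> to a sequence with law
  \<open>S\<close> gives the law \<open>S\<close> again (\<open>PiM_iter\<close>); Fubini then
  isolates the first step.\<close>

lemma nn_integral_first_step:
  assumes [measurable]: "f \<in> borel_measurable S"
  shows "(\<integral>\<^sup>+ \<omega>. f \<omega> \<partial>S) = (\<integral>\<^sup>+ v. \<integral>\<^sup>+ \<omega>. f (case_nat v \<omega>) \<partial>S \<partial>\<mu>)"
proof -
  have "(\<integral>\<^sup>+ \<omega>. f \<omega> \<partial>S) = (\<integral>\<^sup>+ \<omega>. f \<omega> \<partial>distr (\<mu> \<Otimes>\<^sub>M S) S (\<lambda>(v, \<omega>). case_nat v \<omega>))"
    by (simp add: PiM_iter)
  also have "\<dots> = (\<integral>\<^sup>+ (v, \<omega>). f (case_nat v \<omega>) \<partial>(\<mu> \<Otimes>\<^sub>M S))"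
    by (subst nn_integral_distr) (auto simp: case_prod_beta')
  also have "\<dots> = (\<integral>\<^sup>+ v. \<integral>\<^sup>+ \<omega>. f (case_nat v \<omega>) \<partial>S \<partial>\<mu>)"
    by (subst P.nn_integral_fst[symmetric]) auto
  finally show ?thesis .
qed

text \<open>Induction on \<open>n\<close> by conditioning on the first step: avoiding
  \<open>E\<close> contributes one factor Q, and the rest is a first passage from
  \<open>x + v\<close>. Hence \<open>x\<close> must be arbitrary in the induction.\<close>

lemma emeasure_first_passage:
  assumes [measurable]: "E \<in> sets (borel \<Otimes>\<^sub>M borel)" "C \<in> sets borel"
  shows "emeasure S (first_passage E C x n) =
    (edge_step \<mu> (- E) ^^ n) (edge_step \<mu> E (indicator C)) x"
proof (induction n arbitrary: x)
  case 0
  have "emeasure S (first_passage E C x 0) =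
      (\<integral>\<^sup>+ v. \<integral>\<^sup>+ \<omega>. indicator (first_passage E C x 0) (case_nat v \<omega>) \<partial>S \<partial>\<mu>)"
    by (subst nn_integral_first_step[symmetric]) auto
  \<comment> \<open>The event depends on the first step alone, so the integral over the later steps
    is the total mass 1.\<close>
  also have "\<dots> = (\<integral>\<^sup>+ v. indicator E (x, x + v) * indicator C (x + v) \<partial>\<mu>)"
    by (intro nn_integral_cong)
      (auto simp: first_passage_def indicator_def emeasure_space_1[simplified])
  finally show ?case
    by (simp add: edge_step_def)
next
  case (Suc n)
  have "emeasure S (first_passage E C x (Suc n)) =
      (\<integral>\<^sup>+ v. \<integral>\<^sup>+ \<omega>. indicator (first_passage E C x (Suc n)) (case_nat v \<omega>) \<partial>S \<partial>\<mu>)"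
    by (subst nn_integral_first_step[symmetric]) auto
  also have "\<dots> = (\<integral>\<^sup>+ v. \<integral>\<^sup>+ \<omega>. indicator (- E) (x, x + v) *
      indicator (first_passage E C (x + v) n) \<omega> \<partial>S \<partial>\<mu>)"
    by (intro nn_integral_cong) (auto simp: first_passage_Suc indicator_def)
  also have "\<dots> = (\<integral>\<^sup>+ v. indicator (- E) (x, x + v) *
      emeasure S (first_passage E C (x + v) n) \<partial>\<mu>)"
    by (simp add: nn_integral_cmult)
  finally show ?case
    by (simp add: Suc.IH edge_step_def)
qed

text \<open>Countable additivity over the disjoint passage times yields the series for K in the
  overview.\<close>

lemma emeasure_ex_first_passage:
  assumes [measurable]: "E \<in> sets (borel \<Otimes>\<^sub>M borel)" "C \<in> sets borel"
  shows "emeasure S {\<omega>. \<exists>n. \<omega> \<in> first_passage E C x n} =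
    (\<Sum>n. (edge_step \<mu> (- E) ^^ n) (edge_step \<mu> E (indicator C)) x)"
proof -
  have "{\<omega>. \<exists>n. \<omega> \<in> first_passage E C x n} = (\<Union>n. first_passage E C x n)"
    by auto
  then show ?thesis
    by (simp add: suminf_emeasure[symmetric] disjoint_family_first_passage image_subset_iff
        emeasure_first_passage[symmetric])
qed

end

section \<open>Duality with the reflected walk\<close>

text \<open>Translation invariance of \<open>L\<close> makes the steps of the reflected walk, along
  reversed edges, adjoint to those of the walk.\<close>

lemma edge_step_adjoint:
  fixes L :: "'a::euclidean_space measure"
  assumes mu: "prob_space \<mu>" "sets \<mu> = sets borel"
    and L: "sigma_finite_measure L" "sets L = sets borel"
    and inv: "AE v in \<mu>. distr L borel (\<lambda>x. x + v) = L"
    and E [measurable]: "E \<in> sets (borel \<Otimes>\<^sub>M borel)"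
    and f [measurable]: "f \<in> borel_measurable borel"
    and g [measurable]: "g \<in> borel_measurable borel"
  shows "(\<integral>\<^sup>+ x. f x * edge_step \<mu> E g x \<partial>L) =
    (\<integral>\<^sup>+ x. edge_step (distr \<mu> borel uminus) (E\<inverse>) f x * g x \<partial>L)"
proof -
  note [measurable_cong] = mu(2) L(2)
  have space [simp]: "space \<mu> = UNIV" "space L = UNIV"
    using mu(2) L(2) by (auto dest: sets_eq_imp_space_eq)
  interpret mu: prob_space \<mu> by fact
  interpret L: sigma_finite_measure L by fact
  interpret pair_sigma_finite L \<mu> ..
  have "(\<integral>\<^sup>+ x. f x * edge_step \<mu> E g x \<partial>L) =
      (\<integral>\<^sup>+ x. \<integral>\<^sup>+ v. f x * (indicator E (x, x + v) * g (x + v)) \<partial>\<mu> \<partial>L)"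
    by (simp add: edge_step_def nn_integral_cmult)
  also have "\<dots> = (\<integral>\<^sup>+ v. \<integral>\<^sup>+ x. f x * (indicator E (x, x + v) * g (x + v)) \<partial>L \<partial>\<mu>)"
    by (rule Fubini'[symmetric]) measurable
  also have "\<dots> = (\<integral>\<^sup>+ v. \<integral>\<^sup>+ x. f (x - v) * (indicator E (x - v, x) * g x) \<partial>L \<partial>\<mu>)"
  proof (rule nn_integral_cong_AE)
    show "AE v in \<mu>. (\<integral>\<^sup>+ x. f x * (indicator E (x, x + v) * g (x + v)) \<partial>L) =
        (\<integral>\<^sup>+ x. f (x - v) * (indicator E (x - v, x) * g x) \<partial>L)"
      using inv
    proof eventually_elim
      case (elim v)
      have "(\<integral>\<^sup>+ x. f (x - v) * (indicator E (x - v, x) * g x) \<partial>L) =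
          (\<integral>\<^sup>+ x. f (x - v) * (indicator E (x - v, x) * g x) \<partial>distr L borel (\<lambda>x. x + v))"
        by (simp add: elim)
      also have "\<dots> = (\<integral>\<^sup>+ x. f x * (indicator E (x, x + v) * g (x + v)) \<partial>L)"
        by (subst nn_integral_distr) auto
      finally show ?case by simp
    qed
  qed
  also have "\<dots> = (\<integral>\<^sup>+ x. \<integral>\<^sup>+ v. f (x - v) * (indicator E (x - v, x) * g x) \<partial>\<mu> \<partial>L)"
    by (rule Fubini') measurable
  also have "\<dots> = (\<integral>\<^sup>+ x. edge_step (distr \<mu> borel uminus) (E\<inverse>) f x * g x \<partial>L)"
  proof (rule nn_integral_cong)
    fix x
    have "(\<integral>\<^sup>+ v. f (x - v) * (indicator E (x - v, x) * g x) \<partial>\<mu>) =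
        (\<integral>\<^sup>+ v. (indicator (E\<inverse>) (x, x - v) * f (x - v)) * g x \<partial>\<mu>)"
      by (intro nn_integral_cong) (auto simp: indicator_def)
    also have "\<dots> = edge_step (distr \<mu> borel uminus) (E\<inverse>) f x * g x"
      unfolding edge_step_def by (subst nn_integral_distr) (auto simp: nn_integral_multc)
    finally show "(\<integral>\<^sup>+ v. f (x - v) * (indicator E (x - v, x) * g x) \<partial>\<mu>) =
        edge_step (distr \<mu> borel uminus) (E\<inverse>) f x * g x" .
  qed
  finally show ?thesis .
qed

lemma iid_walkI: "prob_space \<mu> \<Longrightarrow> sets \<mu> = sets borel \<Longrightarrow> iid_walk \<mu>"
  by (simp add: iid_walk_def iid_walk_axioms_def sequence_space_def product_prob_spaceI)

text \<open>The operators are moved one at a time from \<open>g\<close> to \<open>f\<close>, so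
  \<open>f\<close> is arbitrary in the induction; \<open>funpow_swap1\<close> places each moved
  operator innermost.\<close>

lemma edge_step_iterate_adjoint:
  fixes L :: "'a::euclidean_space measure"
  assumes mu: "iid_walk \<mu>" and nu: "iid_walk (distr \<mu> borel uminus)"
    and L: "sigma_finite_measure L" "sets L = sets borel"
    and inv: "AE v in \<mu>. distr L borel (\<lambda>x. x + v) = L"
    and E [measurable]: "E \<in> sets (borel \<Otimes>\<^sub>M borel)" "E\<inverse> \<in> sets (borel \<Otimes>\<^sub>M borel)"
    and f [measurable]: "f \<in> borel_measurable borel"
    and g [measurable]: "g \<in> borel_measurable borel"
  shows "(\<integral>\<^sup>+ x. f x * (edge_step \<mu> E ^^ n) g x \<partial>L) =
    (\<integral>\<^sup>+ x. (edge_step (distr \<mu> borel uminus) (E\<inverse>) ^^ n) f x * g x \<partial>L)"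
  using f
proof (induction n arbitrary: f)
  case (Suc n)
  interpret mu: iid_walk \<mu> by fact
  interpret nu: iid_walk "distr \<mu> borel uminus" by fact
  note [measurable] = Suc.prems
  show ?case
    using edge_step_adjoint[OF mu.M.prob_space_axioms mu.sets_steps L inv E(1) Suc.prems, of "(edge_step \<mu> E ^^ n) g"]
      Suc.IH[of "edge_step (distr \<mu> borel uminus) (E\<inverse>) f"]
    by (simp add: funpow_swap1)
qed simp

text \<open>This is the integral computation of the overview; \<open>hit\<close> says that the
  reflected walk traverses a reversed edge of \<open>E\<close> almost surely.\<close>

lemma nn_integral_edge_balance:
  fixes L :: "'a::euclidean_space measure"
  assumes mu: "iid_walk \<mu>"
    and L: "sigma_finite_measure L" "sets L = sets borel"
    and inv: "AE v in \<mu>. distr L borel (\<lambda>x. x + v) = L"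
    and E [measurable]: "E \<in> sets (borel \<Otimes>\<^sub>M borel)"
    and C [measurable]: "C \<in> sets borel"
    and nu_def: "\<nu> = distr \<mu> borel uminus"
    and hit: "AE x in L. AE \<omega> in PiM UNIV (\<lambda>_::nat. \<nu>).
      \<exists>n. (walk_path x \<omega> (Suc n), walk_path x \<omega> n) \<in> E"
  shows "(\<integral>\<^sup>+ x. edge_step \<nu> (E\<inverse>) (\<lambda>_. 1) x *
      emeasure (PiM UNIV (\<lambda>_::nat. \<mu>)) {\<omega>. \<exists>n. \<omega> \<in> first_passage E C x n} \<partial>L) =
    (\<integral>\<^sup>+ x. edge_step \<nu> (E\<inverse>) (\<lambda>_. 1) x * indicator C x \<partial>L)"
proof -
  interpret mu: iid_walk \<mu> by fact
  have nu: "iid_walk \<nu>"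
    unfolding nu_def by (intro iid_walkI mu.M.prob_space_distr) auto
  interpret nu: iid_walk \<nu> by fact
  note [measurable_cong] = L(2)
  have Einv: "E\<inverse> \<in> sets (borel \<Otimes>\<^sub>M borel)"
    by measurable
  have compl [measurable]: "- E \<in> sets (borel \<Otimes>\<^sub>M borel)" "- (E\<inverse>) \<in> sets (borel \<Otimes>\<^sub>M borel)"
    using sets.compl_sets[OF E] sets.compl_sets[OF Einv]
    by (simp_all add: space_pair_measure Compl_eq_Diff_UNIV)
  have compl_inv: "(- E)\<inverse> = - (E\<inverse>)"
    by auto
  \<comment> \<open>The function R' 1, the density of the candidate measure.\<close>
  define \<rho> where "\<rho> = edge_step \<nu> (E\<inverse>) (\<lambda>_. 1)"
  have [measurable]: "\<rho> \<in> borel_measurable borel"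
    unfolding \<rho>_def by measurable
  \<comment> \<open>The series formula for the reflected walk with end set \<open>UNIV\<close>,
    whose indicator is the constant 1, turns \<open>hit\<close> into a sum equal to 1.\<close>
  have one: "AE x in L. (\<Sum>n. (edge_step \<nu> (- (E\<inverse>)) ^^ n) \<rho> x) = 1"
    using hit
  proof eventually_elim
    case (elim x)
    have "AE \<omega> in nu.S. \<exists>n. \<omega> \<in> first_passage (E\<inverse>) UNIV x n"
      using elim unfolding ex_first_passage_UNIV by simp
    then have "emeasure nu.S {\<omega>. \<exists>n. \<omega> \<in> first_passage (E\<inverse>) UNIV x n} = 1"
      using nu.P.emeasure_eq_1_AE[of "{\<omega>. \<exists>n. \<omega> \<in> first_passage (E\<inverse>) UNIV x n}"]
      by (auto simp: Collect_ex_eq)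
    then show ?case
      by (subst (asm) nu.emeasure_ex_first_passage) (auto simp: \<rho>_def indicator_def)
  qed
  have "(\<integral>\<^sup>+ x. \<rho> x * emeasure mu.S {\<omega>. \<exists>n. \<omega> \<in> first_passage E C x n} \<partial>L) =
      (\<integral>\<^sup>+ x. (\<Sum>n. \<rho> x * (edge_step \<mu> (- E) ^^ n) (edge_step \<mu> E (indicator C)) x) \<partial>L)"
    by (simp add: mu.emeasure_ex_first_passage)
  also have "\<dots> = (\<Sum>n. \<integral>\<^sup>+ x. \<rho> x * (edge_step \<mu> (- E) ^^ n) (edge_step \<mu> E (indicator C)) x \<partial>L)"
    by (rule nn_integral_suminf) measurable
  \<comment> \<open>Adjointness is applied to the edges outside \<open>E\<close>; complement and
    converse commute.\<close>
  also have "\<dots> = (\<Sum>n. \<integral>\<^sup>+ x. (edge_step \<nu> (- (E\<inverse>)) ^^ n) \<rho> x * edge_step \<mu> E (indicator C) x \<partial>L)"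
    using edge_step_iterate_adjoint[OF mu _ L inv compl(1), folded nu_def, OF nu]
    by (simp add: compl_inv)
  also have "\<dots> = (\<integral>\<^sup>+ x. (\<Sum>n. (edge_step \<nu> (- (E\<inverse>)) ^^ n) \<rho> x) * edge_step \<mu> E (indicator C) x \<partial>L)"
    by (subst nn_integral_suminf[symmetric]) auto
  also have "\<dots> = (\<integral>\<^sup>+ x. 1 * edge_step \<mu> E (indicator C) x \<partial>L)"
    using one by (intro nn_integral_cong_AE) auto
  also have "\<dots> = (\<integral>\<^sup>+ x. \<rho> x * indicator C x \<partial>L)"
    unfolding \<rho>_def nu_def
    by (rule edge_step_adjoint[OF mu.M.prob_space_axioms mu.sets_steps L inv E]) measurable
  finally show ?thesis
    by (simp add: \<rho>_def)
qed

section \<open>Exceeding every level\<close>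

context iid_walk
begin

section \<open>Independence of past and future steps\<close>

abbreviation shift :: "nat \<Rightarrow> (nat \<Rightarrow> 'a) \<Rightarrow> nat \<Rightarrow> 'a" where
  "shift m \<omega> \<equiv> (\<lambda>i. \<omega> (i + m))"

lemma shift_measurable [measurable]: "shift m \<in> measurable S S"
  by (rule measurable_PiM_single') (auto simp: space_PiM)

text \<open>\<open>past\<close> says that \<open>A\<close> is determined by the first
  \<open>m\<close> steps. Gluing the first \<open>m\<close> entries of one sequence to an
  independent second one preserves \<open>S\<close>, and under this gluing the event becomes the
  rectangle \<open>A \<times> B\<close>.\<close>

lemma emeasure_past_future:
  assumes [measurable]: "A \<in> sets S" "B \<in> sets S"
    and past: "\<And>\<omega> \<omega>'. (\<And>i. i < m \<Longrightarrow> \<omega> i = \<omega>' i) \<Longrightarrow> \<omega> \<in> A \<Longrightarrow> \<omega>' \<in> A"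
  shows "emeasure S {\<omega>. \<omega> \<in> A \<and> shift m \<omega> \<in> B} = emeasure S A * emeasure S B"
proof -
  have meas: "{\<omega>. \<omega> \<in> A \<and> shift m \<omega> \<in> B} \<in> sets S"
  proof -
    have "{\<omega> \<in> space S. \<omega> \<in> A \<and> shift m \<omega> \<in> B} \<in> sets S" by measurable
    then show ?thesis by simp
  qed
  have A: "comb_seq m \<omega> \<omega>' \<in> A \<longleftrightarrow> \<omega> \<in> A" for \<omega> \<omega>'
    using past[of \<omega> "comb_seq m \<omega> \<omega>'"] past[of "comb_seq m \<omega> \<omega>'" \<omega>]
    by (auto simp: comb_seq_less)
  have "emeasure S {\<omega>. \<omega> \<in> A \<and> shift m \<omega> \<in> B} =
      emeasure (distr (S \<Otimes>\<^sub>M S) S (\<lambda>(\<omega>, \<omega>'). comb_seq m \<omega> \<omega>')) {\<omega>. \<omega> \<in> A \<and> shift m \<omega> \<in> B}"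
    by (simp add: PiM_comb_seq)
  also have "\<dots> = emeasure (S \<Otimes>\<^sub>M S) (A \<times> B)"
    using meas by (subst emeasure_distr)
      (auto simp: A comb_seq_add space_pair_measure measurable_comb_seq intro!: arg_cong2[where f = emeasure])
  also have "\<dots> = emeasure S A * emeasure S B"
    by (rule P.emeasure_pair_measure_Times) measurable
  finally show ?thesis .
qed

lemma distr_shift: "distr S S (shift m) = S"
proof (rule measure_eqI)
  fix B assume "B \<in> sets (distr S S (shift m))"
  then show "emeasure (distr S S (shift m)) B = emeasure S B"
    using emeasure_past_future[of UNIV B m] sets.top[of S] emeasure_space_1
    by (subst emeasure_distr) (auto simp: vimage_def)
qed simp

lemma AE_shift:
  assumes "AE \<omega> in S. P \<omega>"
  shows "AE \<omega> in S. \<forall>m. P (shift m \<omega>)"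
proof -
  have "AE \<omega> in S. P (shift m \<omega>)" for m
  proof (rule AE_distrD[OF shift_measurable])
    show "AE \<omega> in distr S S (shift m). P \<omega>"
      unfolding distr_shift by (rule assms)
  qed
  then show ?thesis
    by (simp add: AE_all_countable)
qed

lemma walk_path_shift: "walk_path 0 (shift m \<omega>) n = walk_path 0 \<omega> (n + m) - walk_path 0 \<omega> m"
  by (induction n) (simp_all add: walk_path_Suc)

text \<open>Wait until \<open>a\<close> is exceeded, then until the continuation exceeds
  \<open>b\<close>. The waiting time is random, which is covered because the second event holds
  almost surely after all shifts at once.\<close>

lemma AE_exceeds_add:
  assumes "AE \<omega> in S. \<exists>n. a <e walk_path 0 \<omega> n" "AE \<omega> in S. \<exists>n. b <e walk_path 0 \<omega> n"
  shows "AE \<omega> in S. \<exists>n. a + b <e walk_path 0 \<omega> n"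
  using assms(1) AE_shift[OF assms(2)]
proof eventually_elim
  case (elim \<omega>)
  then obtain m n where "a <e walk_path 0 \<omega> m" "b <e walk_path 0 \<omega> (n + m) - walk_path 0 \<omega> m"
    unfolding walk_path_shift by blast
  then have "a + b <e walk_path 0 \<omega> (n + m)"
    by (fastforce simp: eucl_less_def inner_simps)
  then show ?case ..
qed

text \<open>A walk that stays below \<open>\<epsilon> One\<close> forever is below \<open>\<epsilon> One\<close> at its first entrance
  into the positive orthant, and its continuation after that time stays below \<open>\<epsilon> One\<close> as well.
  This bounds the probability of staying below by a proper fraction of itself.\<close>

lemma AE_exceeds_epsilon:
  assumes pos: "AE \<omega> in S. \<exists>n. 0 <e walk_path 0 \<omega> n"
  obtains \<epsilon> :: real where "0 < \<epsilon>" "AE \<omega> in S. \<exists>n. \<epsilon> *\<^sub>R One <e walk_path 0 \<omega> n"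
proof -
  \<comment> \<open>\<open>T n\<close>: the first entrance into the open orthant is at time
    \<open>n\<close>. \<open>H \<epsilon> n\<close>: the walk is above the level at time
    \<open>n\<close>. Below, \<open>D\<close> and \<open>V\<close> say that at the first entrance
    the level is or is not exceeded, and \<open>N\<close> that it never is.\<close>
  define T where "T n = {\<omega>. 0 <e walk_path 0 \<omega> n \<and> (\<forall>j<n. \<not> 0 <e walk_path (0::'a) \<omega> j)}" for n
  define H where "H \<epsilon> n = {\<omega>. \<epsilon> *\<^sub>R One <e walk_path (0::'a) \<omega> n}" for \<epsilon> :: real and n
  have [measurable]: "Measurable.pred S (\<lambda>\<omega>. a <e walk_path 0 \<omega> n)" for a n
    unfolding eucl_less_def by measurable
  have "{\<omega> \<in> space S. \<omega> \<in> T n} \<in> sets S" "{\<omega> \<in> space S. \<omega> \<in> H \<epsilon> n} \<in> sets S" for n \<epsilon>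
    unfolding T_def H_def mem_Collect_eq by measurable
  then have [measurable]: "T n \<in> sets S" "H \<epsilon> n \<in> sets S" for n \<epsilon>
    by simp_all
  have T_unique: "m = n" if "\<omega> \<in> T m" "\<omega> \<in> T n" for m n \<omega>
    using that by (cases m n rule: linorder_cases) (auto simp: T_def)
  have T: "AE \<omega> in S. \<exists>n. \<omega> \<in> T n"
    using pos
  proof eventually_elim
    case (elim \<omega>)
    then have "\<omega> \<in> T (LEAST n. 0 <e walk_path 0 \<omega> n)"
      by (auto simp: T_def intro: LeastI dest: not_less_Least)
    then show ?case ..
  qed
  have H_ex: "\<exists>k. \<omega> \<in> H (1 / real (Suc k)) n" if "\<omega> \<in> T n" for \<omega> n
  proof -
    \<comment> \<open>The least of the finitely many coordinates is positive, hence above some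
      \<open>1 / real (Suc k)\<close>.\<close>
    have "0 < walk_path 0 \<omega> n \<bullet> i" if "i \<in> Basis" for i
      using \<open>\<omega> \<in> T n\<close> that by (auto simp: T_def eucl_less_def)
    then have "0 < Min ((\<lambda>i. walk_path 0 \<omega> n \<bullet> i) ` Basis)"
      by (subst Min_gr_iff) auto
    then obtain k where k: "1 / real (Suc k) < Min ((\<lambda>i. walk_path 0 \<omega> n \<bullet> i) ` Basis)"
      using nat_approx_posE by blast
    then have "1 / real (Suc k) < walk_path 0 \<omega> n \<bullet> i" if "i \<in> Basis" for i
      using that by (subst (asm) Min_gr_iff) auto
    then have "\<omega> \<in> H (1 / real (Suc k)) n"
      by (auto simp: H_def eucl_less_def)
    then show ?thesis ..
  qed
  define D where "D \<epsilon> = (\<Union>n. T n \<inter> H \<epsilon> n)" for \<epsilon>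
  have [measurable]: "D \<epsilon> \<in> sets S" for \<epsilon>
    unfolding D_def by measurable
  \<comment> \<open>Otherwise countably many null sets would cover almost every path, since each
    first entrance point exceeds one of the levels.\<close>
  have "\<exists>k. emeasure S (D (1 / real (Suc k))) \<noteq> 0"
  proof (rule ccontr)
    assume "\<not> ?thesis"
    then have "AE \<omega> in S. \<forall>k. \<omega> \<notin> D (1 / real (Suc k))"
      unfolding AE_all_countable by (intro allI AE_not_in null_setsI) simp_all
    with T have "AE \<omega> in S. False"
    proof eventually_elim
      case (elim \<omega>)
      then obtain n where n: "\<omega> \<in> T n"
        by blast
      obtain k where "\<omega> \<in> H (1 / real (Suc k)) n"
        using H_ex[OF n] ..
      with n have "\<omega> \<in> D (1 / real (Suc k))"
        unfolding D_def by blast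
      with elim show False
        by blast
    qed
    then show False
      by simp
  qed
  then obtain k where k: "emeasure S (D (1 / real (Suc k))) \<noteq> 0" ..
  define \<epsilon> where "\<epsilon> = 1 / real (Suc k)"
  define N where "N = - (\<Union>n. H \<epsilon> n)"
  have [measurable]: "N \<in> sets S"
    unfolding N_def using sets.compl_sets[of "\<Union>n. H \<epsilon> n" S] by (simp add: Compl_eq_Diff_UNIV)
  define V where "V = (\<Union>n. T n - H \<epsilon> n)"
  have [measurable]: "V \<in> sets S"
    unfolding V_def by measurable
  \<comment> \<open>At the first entrance all coordinates are positive, so a continuation gaining
    more than the level would lift the walk itself above it.\<close>
  have N_shift: "shift n \<omega> \<in> N" if "\<omega> \<in> N" "\<omega> \<in> T n" for n \<omega>
  proof (rule ccontr)
    assume "shift n \<omega> \<notin> N"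
    then obtain j where "\<epsilon> *\<^sub>R One <e walk_path 0 \<omega> (j + n) - walk_path 0 \<omega> n"
      by (auto simp: N_def H_def walk_path_shift)
    moreover have "0 <e walk_path 0 \<omega> n"
      using that by (simp add: T_def)
    ultimately have "\<epsilon> *\<^sub>R One <e walk_path 0 \<omega> (j + n)"
      by (fastforce simp: eucl_less_def inner_simps)
    with \<open>\<omega> \<in> N\<close> show False
      by (auto simp: N_def H_def)
  qed
  have past: "\<omega>' \<in> T n - H \<epsilon> n" if eq: "\<And>i. i < n \<Longrightarrow> \<omega> i = \<omega>' i" and "\<omega> \<in> T n - H \<epsilon> n" for \<omega> \<omega>' n
  proof -
    have "walk_path 0 \<omega>' j = walk_path 0 \<omega> j" if "j \<le> n" for j
      using that eq by (auto simp: walk_path_def)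
    then show ?thesis
      using \<open>\<omega> \<in> T n - H \<epsilon> n\<close> by (auto simp: T_def H_def)
  qed
  have part [measurable]: "{\<omega>. \<omega> \<in> T n - H \<epsilon> n \<and> shift n \<omega> \<in> N} \<in> sets S" for n
  proof -
    have "{\<omega> \<in> space S. \<omega> \<in> T n - H \<epsilon> n \<and> shift n \<omega> \<in> N} \<in> sets S" by measurable
    then show ?thesis by simp
  qed
  have split: "emeasure S {\<omega>. \<omega> \<in> T n - H \<epsilon> n \<and> shift n \<omega> \<in> N} =
      emeasure S (T n - H \<epsilon> n) * emeasure S N" for n
    by (rule emeasure_past_future) (measurable, rule past)
  \<comment> \<open>Splitting at the first entrance and using independence gives
    \<open>prob N \<le> prob V * prob N\<close>.\<close>
  have "emeasure S N \<le> emeasure S (\<Union>n. {\<omega>. \<omega> \<in> T n - H \<epsilon> n \<and> shift n \<omega> \<in> N})"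
  proof (rule emeasure_mono_AE)
    show "AE \<omega> in S. \<omega> \<in> N \<longrightarrow> \<omega> \<in> (\<Union>n. {\<omega>. \<omega> \<in> T n - H \<epsilon> n \<and> shift n \<omega> \<in> N})"
      using T by eventually_elim (use N_shift in \<open>auto simp: N_def\<close>)
  qed measurable
  also have "\<dots> \<le> (\<Sum>n. emeasure S {\<omega>. \<omega> \<in> T n - H \<epsilon> n \<and> shift n \<omega> \<in> N})"
    by (rule emeasure_subadditive_countably) (use part in auto)
  also have "\<dots> = (\<Sum>n. emeasure S (T n - H \<epsilon> n)) * emeasure S N"
    unfolding split by simp
  also have "(\<Sum>n. emeasure S (T n - H \<epsilon> n)) = emeasure S V"
    unfolding V_def
    by (rule suminf_emeasure) (auto simp: disjoint_family_on_def dest: T_unique)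
  finally have "prob N \<le> prob V * prob N"
    by (simp add: P.emeasure_eq_measure flip: ennreal_mult)
  \<comment> \<open>The first entrance time is unique, so \<open>V\<close> misses
    \<open>D \<epsilon>\<close>, which has positive probability by the choice of
    \<open>\<epsilon>\<close>.\<close>
  moreover have "prob V < 1"
  proof -
    have "V \<inter> D \<epsilon> = {}"
      unfolding V_def D_def by (auto dest: T_unique)
    then have "prob V + prob (D \<epsilon>) = prob (V \<union> D \<epsilon>)"
      by (simp add: P.finite_measure_Union)
    then have "prob V + prob (D \<epsilon>) \<le> 1"
      by simp
    moreover have "prob (D \<epsilon>) \<noteq> 0"
      using k by (simp add: P.emeasure_eq_measure \<epsilon>_def)
    ultimately show ?thesis
      using measure_nonneg[of S "D \<epsilon>"] by linarith
  qed
  ultimately have "prob N = 0"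
    by (metis measure_nonneg mult_le_cancel_right1 not_less order_le_less)
  then have "AE \<omega> in S. \<omega> \<notin> N"
    by (intro AE_not_in null_setsI) (auto simp: P.emeasure_eq_measure)
  then have "AE \<omega> in S. \<exists>n. \<epsilon> *\<^sub>R One <e walk_path 0 \<omega> n"
    by eventually_elim (auto simp: N_def H_def)
  then show ?thesis
    using that[of \<epsilon>] by (simp add: \<epsilon>_def)
qed

text \<open>Adding the level repeatedly reaches every multiple of \<open>\<epsilon>\<close>. These
  countably many levels, after all shifts, control every \<open>x\<close> simultaneously.\<close>

lemma AE_exceeds_infinitely_often:
  assumes pos: "AE \<omega> in S. \<exists>n. 0 <e walk_path 0 \<omega> n"
  shows "AE \<omega> in S. \<forall>x m. \<exists>n\<ge>m. x <e walk_path 0 \<omega> n"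
proof -
  obtain \<epsilon> where \<epsilon>: "0 < \<epsilon>" "AE \<omega> in S. \<exists>n. \<epsilon> *\<^sub>R One <e walk_path 0 \<omega> n"
    using AE_exceeds_epsilon[OF pos] .
  have "AE \<omega> in S. \<exists>n. (real k * \<epsilon>) *\<^sub>R One <e walk_path 0 \<omega> n" for k
  proof (induction k)
    case (Suc k)
    show ?case
      using AE_exceeds_add[OF \<epsilon>(2) Suc.IH] by (simp add: distrib_right scaleR_add_left)
  qed (use pos in simp)
  then have "AE \<omega> in S. \<forall>m k. \<exists>n. (real k * \<epsilon>) *\<^sub>R One <e walk_path 0 (shift m \<omega>) n"
    using AE_shift[of "\<lambda>\<omega>. \<forall>k. \<exists>n. (real k * \<epsilon>) *\<^sub>R One <e walk_path 0 \<omega> n"]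
    by (simp add: AE_all_countable)
  then show ?thesis
  proof eventually_elim
    case (elim \<omega>)
    show ?case
    proof (intro allI)
      fix x m
      \<comment> \<open>A gain above \<open>real k * \<epsilon>\<close> in each coordinate after
        time \<open>m\<close> closes the gap to \<open>x\<close>, because each coordinate of the gap
        is at most its norm.\<close>
      obtain k where k: "norm (x - walk_path 0 \<omega> m) < real k * \<epsilon>"
        using reals_Archimedean3[OF \<epsilon>(1)] by blast
      obtain n where n: "(real k * \<epsilon>) *\<^sub>R One <e walk_path 0 \<omega> (n + m) - walk_path 0 \<omega> m"
        using elim unfolding walk_path_shift by blast
      have "x \<bullet> i < walk_path 0 \<omega> (n + m) \<bullet> i" if "i \<in> Basis" for i
      proof -
        have "x \<bullet> i - walk_path 0 \<omega> m \<bullet> i < real k * \<epsilon>"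
          using Basis_le_norm[OF that, of "x - walk_path 0 \<omega> m"] k by (simp add: inner_diff_left)
        moreover have "real k * \<epsilon> < walk_path 0 \<omega> (n + m) \<bullet> i - walk_path 0 \<omega> m \<bullet> i"
          using n that by (auto simp: eucl_less_def inner_simps)
        ultimately show ?thesis by simp
      qed
      then have "x <e walk_path 0 \<omega> (n + m)"
        by (simp add: eucl_less_def)
      then show "\<exists>n\<ge>m. x <e walk_path 0 \<omega> n"
        by (intro exI[of _ "n + m"]) simp
    qed
  qed
qed

end

section \<open>Random walks on their state space\<close>

text \<open>Every point outside the support lies in a null set of a countable basis, and the union
  of these null sets is null.\<close>

lemma AE_topological_support:
  fixes \<mu> :: "'a::second_countable_topology measure"
  assumes sets: "sets \<mu> = sets borel"
  shows "AE v in \<mu>. v \<in> topological_support \<mu>"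
proof -
  obtain B :: "'a set set" where B: "countable B" "topological_basis B"
    using ex_countable_basis by blast
  have "AE v in \<mu>. \<forall>U\<in>{U \<in> B. emeasure \<mu> U = 0}. v \<notin> U"
    using B by (subst AE_ball_countable)
      (auto intro!: AE_not_in null_setsI simp: sets topological_basis_open)
  then show ?thesis
  proof eventually_elim
    case (elim v)
    show ?case
      unfolding topological_support_def mem_Collect_eq
    proof (intro allI impI)
      fix W assume "open W" "v \<in> W"
      then obtain U where U: "U \<in> B" "v \<in> U" "U \<subseteq> W"
        using B(2) by (auto elim: topological_basisE)
      then have "emeasure \<mu> U \<noteq> 0"
        using elim by auto
      moreover have "emeasure \<mu> U \<le> emeasure \<mu> W"
        using \<open>open W\<close> U by (intro emeasure_mono) (auto simp: sets)
      ultimately show "emeasure \<mu> W > 0"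
        by (metis le_zero_eq zero_less_iff_neq_zero)
    qed
  qed
qed

lemma closed_add_subgroup_hull: "closed_add_subgroup (closed_add_subgroup hull A)"
  by (rule hull_in) (auto simp: closed_add_subgroup_def intro!: closed_Inter)

text \<open>Unfolds the infimum into first-passage form. Event times start at 1, hence the
  successors; with no event the infimum of the empty set is infinite.\<close>

lemma event_time_1_iff:
  "event_time Q 1 < \<infinity> \<and> s (the_enat (event_time Q 1)) \<in> C \<longleftrightarrow>
    (\<exists>n. Q (Suc n) \<and> s (Suc n) \<in> C \<and> (\<forall>j<n. \<not> Q (Suc j)))"
proof (cases "\<exists>n. Q (Suc n)")
  case True
  define n where "n = (LEAST n. Q (Suc n))"
  have n: "Q (Suc n)" "\<And>j. j < n \<Longrightarrow> \<not> Q (Suc j)"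
    using True unfolding n_def by (auto intro: LeastI dest: not_less_Least)
  have "event_time Q 1 = Inf {enat k | k. enat k > 0 \<and> Q k}"
    by simp
  also have "\<dots> = enat (Suc n)"
  proof (rule cInf_eq_minimum)
    show "enat (Suc n) \<in> {enat k | k. enat k > 0 \<and> Q k}"
      using n(1) by (auto simp: zero_enat_def)
    fix y assume "y \<in> {enat k | k. enat k > 0 \<and> Q k}"
    then obtain j where "y = enat (Suc j)" "Q (Suc j)"
      by (auto simp: zero_enat_def gr0_conv_Suc)
    then show "enat (Suc n) \<le> y"
      using n(2) by (auto simp: not_less[symmetric])
  qed
  finally have time: "event_time Q 1 = enat (Suc n)" .
  have "m = n" if "Q (Suc m)" "\<forall>j<m. \<not> Q (Suc j)" for m
    using that n by (metis linorder_neqE_nat)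
  then have "(\<exists>n. Q (Suc n) \<and> s (Suc n) \<in> C \<and> (\<forall>j<n. \<not> Q (Suc j))) \<longleftrightarrow> s (Suc n) \<in> C"
    using n by blast
  then show ?thesis
    unfolding time by simp
next
  case False
  then have empty: "{enat k | k. enat k > 0 \<and> Q k} = {}"
    by (auto simp: zero_enat_def gr0_conv_Suc)
  have "event_time Q 1 = Inf {enat k | k. enat k > 0 \<and> Q k}"
    by simp
  also have "\<dots> = \<infinity>"
    unfolding empty by (simp add: top_enat_def)
  finally have "event_time Q 1 = \<infinity>" .
  then show ?thesis
    using False by simp
qed

locale random_walk_on =
  fixes M :: "'w measure" and X :: "nat \<Rightarrow> 'w \<Rightarrow> 'a::euclidean_space"
  assumes random_walk: "random_walk M X"
begin

sublocale prob_space M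
  using random_walk by (simp add: random_walk_def)

abbreviation "G \<equiv> state_space M X"
abbreviation "\<mu> \<equiv> distr M borel (X 1)"
abbreviation "\<nu> \<equiv> distr \<mu> borel uminus"

lemma X_measurable [measurable]: "X (Suc n) \<in> borel_measurable M"
  using random_walk by (auto simp: random_walk_def indep_vars_def)

lemma X_1_measurable [measurable]: "X 1 \<in> borel_measurable M"
  using X_measurable[of 0] by simp

lemma distr_X: "1 \<le> i \<Longrightarrow> distr M borel (X i) = \<mu>"
  using random_walk unfolding random_walk_def by blast

lemma iid_walk_mu: "iid_walk \<mu>"
  by (intro iid_walkI prob_space_distr) auto

lemma iid_walk_nu: "iid_walk \<nu>"
  by (intro iid_walkI prob_space_distr prob_space.prob_space_distr) auto

text \<open>Independence gives a product law on the index set \<open>{1..}\<close>, and reindexing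
  by \<open>Suc\<close> moves it to all naturals. The map \<open>g\<close> will be the identity or
  negation.\<close>

lemma distr_increments:
  assumes [measurable]: "g \<in> borel_measurable borel"
  shows "distr M (PiM UNIV (\<lambda>_::nat. borel :: 'a measure)) (\<lambda>\<omega> i. g (X (Suc i) \<omega>)) =
    PiM UNIV (\<lambda>_::nat. distr \<mu> borel g)"
proof -
  interpret g: prob_space "distr \<mu> borel g"
    by (intro prob_space.prob_space_distr prob_space_distr) auto
  have meas: "X i \<in> borel_measurable M" if "i \<in> {1..}" for i
    using that X_measurable by (cases i) auto
  have "indep_vars (\<lambda>_. borel) X {1..}"
    using random_walk by (simp add: random_walk_def)
  then have "indep_vars (\<lambda>_. borel) (\<lambda>i \<omega>. g (X i \<omega>)) {1..}"
    by (rule indep_vars_compose2) simp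
  then have "distr M (PiM {1..} (\<lambda>_. borel)) (\<lambda>\<omega>. \<lambda>i\<in>{1..}. g (X i \<omega>)) =
      PiM {1..} (\<lambda>i. distr M borel (\<lambda>\<omega>. g (X i \<omega>)))"
    by (subst (asm) indep_vars_iff_distr_eq_PiM') (use meas in auto)
  also have "\<dots> = PiM {1..} (\<lambda>_. distr \<mu> borel g)"
  proof (rule PiM_cong)
    fix i :: nat assume i: "i \<in> {1..}"
    have "distr M borel (\<lambda>\<omega>. g (X i \<omega>)) = distr (distr M borel (X i)) borel g"
      using meas[OF i] by (subst distr_distr) (auto simp: o_def)
    also have "distr M borel (X i) = \<mu>"
      using i by (intro distr_X) simp
    finally show "distr M borel (\<lambda>\<omega>. g (X i \<omega>)) = distr \<mu> borel g" .
  qed simp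
  finally have "PiM UNIV (\<lambda>_::nat. distr \<mu> borel g) =
      distr (distr M (PiM {1..} (\<lambda>_. borel)) (\<lambda>\<omega>. \<lambda>i\<in>{1..}. g (X i \<omega>)))
        (PiM UNIV (\<lambda>_. distr \<mu> borel g)) (\<lambda>\<omega>. \<lambda>n\<in>UNIV. \<omega> (Suc n))"
    using distr_PiM_reindex[of "{1..}" "\<lambda>_. distr \<mu> borel g" Suc UNIV, OF g.prob_space_axioms]
    by simp
  also have "\<dots> = distr M (PiM UNIV (\<lambda>_::nat. distr \<mu> borel g)) (\<lambda>\<omega> i. g (X (Suc i) \<omega>))"
  proof (rule trans[OF distr_distr])
    show "(\<lambda>\<omega>. \<lambda>n\<in>UNIV. \<omega> (Suc n)) \<in>
        measurable (PiM {1..} (\<lambda>_. borel)) (PiM UNIV (\<lambda>_::nat. distr \<mu> borel g))"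
      by (rule measurable_restrict) simp
    show "(\<lambda>\<omega>. \<lambda>i\<in>{1..}. g (X i \<omega>)) \<in> measurable M (PiM {1..} (\<lambda>_. borel))"
      by (rule measurable_restrict) (rule measurable_compose[OF meas], simp_all)
  qed (simp add: o_def restrict_def)
  also have "\<dots> = distr M (PiM UNIV (\<lambda>_::nat. borel)) (\<lambda>\<omega> i. g (X (Suc i) \<omega>))"
    by (intro distr_cong sets_PiM_cong) auto
  finally show ?thesis ..
qed

lemma increments_measurable [measurable]:
  "(\<lambda>\<omega> i. X (Suc i) \<omega>) \<in> measurable M (PiM UNIV (\<lambda>_. borel))"
  "(\<lambda>\<omega> i. - X (Suc i) \<omega>) \<in> measurable M (PiM UNIV (\<lambda>_. borel))"
  by (rule measurable_PiM_single'; auto)+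

lemma distr_increments_mu:
  "distr M (PiM UNIV (\<lambda>_::nat. borel)) (\<lambda>\<omega> i. X (Suc i) \<omega>) = PiM UNIV (\<lambda>_::nat. \<mu>)"
  using distr_increments[of "\<lambda>x. x"] by (simp add: distr_distr o_def)

lemma distr_increments_nu:
  "distr M (PiM UNIV (\<lambda>_::nat. borel)) (\<lambda>\<omega> i. - X (Suc i) \<omega>) = PiM UNIV (\<lambda>_::nat. \<nu>)"
  by (rule distr_increments) auto

lemma walk_law_eq: "walk_law M X x = distr M (PiM UNIV (\<lambda>_. borel)) (\<lambda>\<omega>. walk_path x (\<lambda>i. X (Suc i) \<omega>))"
  by (simp add: walk_law_def walk_path_def[abs_def] sum.atLeast1_atMost_eq)

lemma walk_path_measurable [measurable]:
  "walk_path x \<in> measurable (PiM UNIV (\<lambda>_. borel)) (PiM UNIV (\<lambda>_. borel :: 'a measure))"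
  unfolding walk_path_def by (rule measurable_PiM_single') auto

text \<open>Bridge from the kernel on path space to first passages on the product space of
  increments.\<close>

lemma event_kernel_eq:
  assumes [measurable]: "E \<in> sets (borel \<Otimes>\<^sub>M borel)" "C \<in> sets borel"
    and Q: "\<And>s k. Q s k \<longleftrightarrow> (s (k - 1), s k) \<in> E"
  shows "event_kernel M X Q x C =
    emeasure (PiM UNIV (\<lambda>_::nat. \<mu>)) {\<omega>. \<exists>n. \<omega> \<in> first_passage E C x n}"
proof -
  have law: "walk_law M X x = distr (PiM UNIV (\<lambda>_::nat. \<mu>)) (PiM UNIV (\<lambda>_. borel)) (walk_path x)"
    unfolding walk_law_eq distr_increments_mu[symmetric]
    by (subst distr_distr) (auto simp: o_def)
  have [simp]: "space (walk_law M X x) = UNIV"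
    by (simp add: walk_law_def space_PiM)
  define A where "A = {s. \<exists>n. (s n, s (Suc n)) \<in> E \<and> s (Suc n) \<in> C \<and>
    (\<forall>j<n. (s j, s (Suc j)) \<notin> E)}"
  have "event_kernel M X Q x C = emeasure (walk_law M X x) A"
    unfolding event_kernel_def event_time_1_iff Q A_def by simp
  also have "\<dots> = emeasure (PiM UNIV (\<lambda>_::nat. \<mu>)) (walk_path x -` A)"
  proof -
    have "{s \<in> space (PiM UNIV (\<lambda>_. borel)). s \<in> A} \<in> sets (PiM UNIV (\<lambda>_. borel))"
      unfolding A_def mem_Collect_eq by measurable
    then have "A \<in> sets (PiM UNIV (\<lambda>_. borel))"
      by (simp add: space_PiM)
    then show ?thesis
      unfolding law by (subst emeasure_distr) (auto simp: space_PiM)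
  qed
  also have "walk_path x -` A = {\<omega>. \<exists>n. \<omega> \<in> first_passage E C x n}"
    by (auto simp: A_def first_passage_def)
  finally show ?thesis .
qed

section \<open>The state space as a closed subgroup carrying the steps\<close>

lemma closed_add_subgroup_G: "closed_add_subgroup G"
  unfolding state_space_def by (rule closed_add_subgroup_hull)

lemma
  shows closed_G: "closed G"
    and add_in_G: "x \<in> G \<Longrightarrow> y \<in> G \<Longrightarrow> x + y \<in> G"
    and diff_in_G: "x \<in> G \<Longrightarrow> y \<in> G \<Longrightarrow> x - y \<in> G"
proof -
  show "closed G" "x \<in> G \<Longrightarrow> y \<in> G \<Longrightarrow> x + y \<in> G"
    using closed_add_subgroup_G by (auto simp: closed_add_subgroup_def)
  show "x \<in> G \<Longrightarrow> y \<in> G \<Longrightarrow> x - y \<in> G"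
    using closed_add_subgroup_G unfolding closed_add_subgroup_def diff_conv_add_uminus by blast
qed

lemma G_measurable [measurable]: "G \<in> sets borel"
  using closed_G by simp

lemma AE_mu_in_G: "AE v in \<mu>. v \<in> G"
proof -
  have "topological_support \<mu> \<subseteq> G"
    unfolding state_space_def by (rule hull_subset)
  then show ?thesis
    using AE_topological_support[of \<mu>] by auto
qed

lemma AE_X_in_G: "AE \<omega> in M. X (Suc i) \<omega> \<in> G"
proof -
  have "AE v in distr M borel (X (Suc i)). v \<in> G"
    using AE_mu_in_G by (subst distr_X) simp
  then show ?thesis
    by (rule AE_distrD[rotated]) measurable
qed

text \<open>A step of the reflected walk from \<open>x\<close> leads to
  \<open>x - X 1 \<omega>\<close>; traversed backwards it is the edge
  \<open>(x - X 1 \<omega>, x)\<close>. This identifies R' 1 with the densities of the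
  theorem.\<close>

lemma reversed_step_probability:
  assumes [measurable]: "E \<in> sets (borel \<Otimes>\<^sub>M borel)"
  shows "edge_step \<nu> (E\<inverse>) (\<lambda>_. 1) x = emeasure M {\<omega> \<in> space M. (x - X 1 \<omega>, x) \<in> E}"
proof -
  have [measurable]: "E\<inverse> \<in> sets (borel \<Otimes>\<^sub>M borel)"
    using assms by (rule converse_measurable)
  have "edge_step \<nu> (E\<inverse>) (\<lambda>_. 1) x = (\<integral>\<^sup>+ v. indicator (E\<inverse>) (x, x - v) \<partial>\<mu>)"
    unfolding edge_step_def by (subst nn_integral_distr) auto
  also have "\<dots> = (\<integral>\<^sup>+ \<omega>. indicator (E\<inverse>) (x, x - X 1 \<omega>) \<partial>M)"
    by (rule nn_integral_distr) measurable
  also have "\<dots> = (\<integral>\<^sup>+ \<omega>. indicator {\<omega> \<in> space M. (x - X 1 \<omega>, x) \<in> E} \<omega> \<partial>M)"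
    by (intro nn_integral_cong) (auto simp: indicator_def)
  also have "\<dots> = emeasure M {\<omega> \<in> space M. (x - X 1 \<omega>, x) \<in> E}"
    by (rule nn_integral_indicator) measurable
  finally show ?thesis .
qed

section \<open>Oscillation of the reflected walk\<close>

lemma AE_walk_event:
  assumes "\<P>(s in walk_law M X 0. event_time (\<lambda>n. s n \<in> A) 1 < \<infinity>) = 1"
  shows "AE \<omega> in M. \<exists>n. walk_path 0 (\<lambda>i. X (Suc i) \<omega>) n \<in> A"
proof -
  have "prob_space (walk_law M X 0)"
    unfolding walk_law_eq by (rule prob_space_distr) measurable
  then have "AE s in walk_law M X 0. event_time (\<lambda>n. s n \<in> A) 1 < \<infinity>"
    using prob_space.AE_prob_1[OF _ assms] by simp
  then have "AE s in walk_law M X 0. \<exists>n. s n \<in> A"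
  proof eventually_elim
    case (elim s)
    then show ?case
      using event_time_1_iff[of "\<lambda>n. s n \<in> A" s UNIV] by auto
  qed
  then show ?thesis
    unfolding walk_law_eq by (rule AE_distrD[rotated]) measurable
qed

lemma AE_exceeds_infinitely_often_distr:
  assumes "iid_walk \<kappa>"
    and Y [measurable]: "Y \<in> measurable M (PiM UNIV (\<lambda>_::nat. borel))"
    and distr: "distr M (PiM UNIV (\<lambda>_. borel)) Y = PiM UNIV (\<lambda>_. \<kappa>)"
    and pos: "AE \<omega> in M. \<exists>n. 0 <e walk_path 0 (Y \<omega>) n"
  shows "AE \<omega> in M. \<forall>x m. \<exists>n\<ge>m. (x::'a) <e walk_path 0 (Y \<omega>) n"
proof -
  interpret k: iid_walk \<kappa> by fact
  have [measurable]: "Measurable.pred (PiM UNIV (\<lambda>_::nat. borel)) (\<lambda>\<omega>. (0::'a) <e walk_path 0 \<omega> n)" for n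
    unfolding eucl_less_def walk_path_def by measurable
  have "AE \<omega> in distr M (PiM UNIV (\<lambda>_. borel)) Y. \<exists>n. 0 <e walk_path 0 \<omega> n"
    using pos by (subst AE_distr_iff) measurable
  then have "AE \<omega> in k.S. \<exists>n. 0 <e walk_path 0 \<omega> n"
    unfolding distr .
  then have "AE \<omega> in distr M (PiM UNIV (\<lambda>_. borel)) Y. \<forall>x m. \<exists>n\<ge>m. x <e walk_path 0 \<omega> n"
    unfolding distr by (rule k.AE_exceeds_infinitely_often)
  then show ?thesis
    \<comment> \<open>Pulling back by \<open>AE_distrD\<close> asks only for measurability of the
      map, so the uncountable quantifier over \<open>x\<close> is harmless.\<close>
    by (rule AE_distrD[rotated]) measurable
qed

lemma walk_path_uminus: "walk_path x (\<lambda>i. - \<omega> i) n = x - walk_path 0 \<omega> n"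
  by (simp add: walk_path_def sum_negf)

text \<open>The reflected walk from \<open>x\<close> is \<open>x\<close> minus the walk from 0. It
  is negative when the walk exceeds \<open>x\<close>, and positive when the negated walk exceeds
  \<open>- x\<close>.\<close>

lemma AE_reflected_walk_oscillates:
  assumes "\<P>(s in walk_law M X 0. event_time (\<lambda>n. s n \<in> {y. 0 <e y}) 1 < \<infinity>) = 1"
    and "\<P>(s in walk_law M X 0. event_time (\<lambda>n. s n \<in> {y. y <e 0}) 1 < \<infinity>) = 1"
  shows "AE \<omega> in M. \<forall>x m. (\<exists>n\<ge>m. 0 <e walk_path x (\<lambda>i. - X (Suc i) \<omega>) n) \<and>
    (\<exists>n\<ge>m. walk_path x (\<lambda>i. - X (Suc i) \<omega>) n <e 0)"
proof -
  have "AE \<omega> in M. \<forall>x m. \<exists>n\<ge>m. x <e walk_path 0 (\<lambda>i. X (Suc i) \<omega>) n"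
    using AE_walk_event[OF assms(1)]
    by (intro AE_exceeds_infinitely_often_distr[OF iid_walk_mu _ distr_increments_mu]) auto
  moreover have "AE \<omega> in M. \<forall>x m. \<exists>n\<ge>m. x <e walk_path 0 (\<lambda>i. - X (Suc i) \<omega>) n"
    using AE_walk_event[OF assms(2)]
    by (intro AE_exceeds_infinitely_often_distr[OF iid_walk_nu _ distr_increments_nu])
      (auto simp: walk_path_uminus eucl_less_def)
  ultimately show ?thesis
  proof eventually_elim
    case (elim \<omega>)
    show ?case
    proof (intro allI)
      fix x m
      have "\<exists>n\<ge>m. x <e walk_path 0 (\<lambda>i. X (Suc i) \<omega>) n"
        "\<exists>n\<ge>m. - x <e walk_path 0 (\<lambda>i. - X (Suc i) \<omega>) n"
        using elim by blast+
      then show "(\<exists>n\<ge>m. 0 <e walk_path x (\<lambda>i. - X (Suc i) \<omega>) n) \<and>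
          (\<exists>n\<ge>m. walk_path x (\<lambda>i. - X (Suc i) \<omega>) n <e 0)"
        by (fastforce simp: walk_path_uminus eucl_less_def inner_simps)
    qed
  qed
qed

lemma reflected_walk_in_G:
  assumes "x \<in> G" "\<And>i. X (Suc i) \<omega> \<in> G"
  shows "walk_path x (\<lambda>i. - X (Suc i) \<omega>) n \<in> G"
proof (induction n)
  case (Suc n)
  then show ?case
    using diff_in_G[OF Suc.IH assms(2)[of n]] by (simp add: walk_path_Suc)
qed (simp add: assms)

section \<open>Haar measure and invariance for edge chains\<close>

context
  fixes lam :: "'a measure"
  assumes haar: "haar_measure_on G lam"
begin

lemma
  shows sets_haar: "sets lam = sets (restrict_space borel G)"
    and haar_translate: "\<And>z B. z \<in> G \<Longrightarrow> B \<in> sets lam \<Longrightarrow> emeasure lam ((+) z ` B) = emeasure lam B"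
    and haar_compact: "\<And>K. compact K \<Longrightarrow> K \<subseteq> G \<Longrightarrow> emeasure lam K < \<infinity>"
  using haar by (auto simp: haar_measure_on_def)

lemma space_haar: "space lam = G"
  using sets_eq_imp_space_eq[OF sets_haar] by (simp add: space_restrict_space)

text \<open>The Haar measure pushed to a Borel measure on the whole space, as the duality lemmas
  expect.\<close>

abbreviation "L \<equiv> distr lam borel (\<lambda>x. x)"

lemma haar_embedding_measurable [measurable]: "(\<lambda>x. x) \<in> borel_measurable lam"
  unfolding measurable_cong_sets[OF sets_haar refl] by (rule measurable_restrict_space1) simp

lemma emeasure_haar_embedding: "B \<in> sets borel \<Longrightarrow> emeasure L B = emeasure lam (B \<inter> G)"
  by (subst emeasure_distr) (auto simp: space_haar)

text \<open>Closed balls meet the closed set \<open>G\<close> in compact sets, which have finite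
  Haar measure.\<close>

lemma sigma_finite_haar_embedding: "sigma_finite_measure L"
proof
  show "\<exists>A. countable A \<and> A \<subseteq> sets L \<and> \<Union> A = space L \<and> (\<forall>a\<in>A. emeasure L a \<noteq> \<infinity>)"
  proof (intro exI conjI ballI)
    let ?A = "range (\<lambda>n::nat. cball (0::'a) (real n))"
    show "countable ?A" "?A \<subseteq> sets L"
      by auto
    show "\<Union> ?A = space L"
      by (auto simp: dist_norm real_arch_simple)
    fix a assume "a \<in> ?A"
    then obtain n :: nat where a: "a = cball 0 (real n)"
      by auto
    have "emeasure lam (a \<inter> G) < \<infinity>"
      using closed_G unfolding a by (intro haar_compact compact_Int_closed) auto
    then show "emeasure L a \<noteq> \<infinity>"
      unfolding a by (simp add: emeasure_haar_embedding)
  qed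
qed

text \<open>Almost every step lies in \<open>G\<close>, and translation by such a \<open>v\<close>
  maps \<open>G\<close> onto itself and preserves \<open>lam\<close>.\<close>

lemma AE_translate_haar_embedding: "AE v in \<mu>. distr L borel (\<lambda>x. x + v) = L"
  using AE_mu_in_G
proof eventually_elim
  case (elim v)
  show ?case
  proof (rule measure_eqI)
    fix B :: "'a set" assume "B \<in> sets (distr L borel (\<lambda>x. x + v))"
    then have [measurable]: "B \<in> sets borel"
      by simp
    have [measurable]: "(\<lambda>x. x + v) -` B \<in> sets borel"
      using measurable_sets_borel[of "\<lambda>x. x + v" borel B] by simp
    have "emeasure (distr L borel (\<lambda>x. x + v)) B = emeasure lam ((\<lambda>x. x + v) -` B \<inter> G)"
      by (simp add: emeasure_distr[of _ L] emeasure_haar_embedding)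
    also have "\<dots> = emeasure lam ((+) v ` ((\<lambda>x. x + v) -` B \<inter> G))"
      using elim by (intro haar_translate[symmetric]) (auto simp: sets_haar sets_restrict_space)
    also have "(+) v ` ((\<lambda>x. x + v) -` B \<inter> G) = B \<inter> G"
    proof
      show "(+) v ` ((\<lambda>x. x + v) -` B \<inter> G) \<subseteq> B \<inter> G"
        using add_in_G elim by (auto simp: add.commute)
      show "B \<inter> G \<subseteq> (+) v ` ((\<lambda>x. x + v) -` B \<inter> G)"
      proof
        fix y assume "y \<in> B \<inter> G"
        then show "y \<in> (+) v ` ((\<lambda>x. x + v) -` B \<inter> G)"
          using diff_in_G[of y v] elim by (intro image_eqI[of _ _ "y - v"]) auto
      qed
    qed
    finally show "emeasure (distr L borel (\<lambda>x. x + v)) B = emeasure L B"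
      by (simp add: emeasure_haar_embedding)
  qed simp
qed

text \<open>Common form of all three claims, with \<open>D\<close> the state space of the recorded
  chain. By \<open>outside\<close>, the density R' 1 vanishes on \<open>G - D\<close>, so integrals
  over \<open>D\<close> can be taken over \<open>G\<close>.\<close>

lemma invariant_on_edges:
  assumes E [measurable]: "E \<in> sets (borel \<Otimes>\<^sub>M borel)"
    and D [measurable]: "D \<in> sets borel" and "D \<subseteq> G"
    and Q: "\<And>s k. Q s k \<longleftrightarrow> (s (k - 1), s k) \<in> E"
    and dens: "\<And>x. x \<in> D \<Longrightarrow> d x = emeasure M {\<omega> \<in> space M. (x - X 1 \<omega>, x) \<in> E}"
    and outside: "\<And>u x. x \<in> G - D \<Longrightarrow> (u, x) \<notin> E"
    and hit: "\<And>x. x \<in> G \<Longrightarrow> AE \<omega> in M.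
      \<exists>n. (walk_path x (\<lambda>i. - X (Suc i) \<omega>) (Suc n), walk_path x (\<lambda>i. - X (Suc i) \<omega>) n) \<in> E"
  shows "invariant_on D (event_kernel M X Q) (density (restrict_space lam D) d)"
proof -
  interpret mu: iid_walk \<mu> by (rule iid_walk_mu)
  interpret nu: iid_walk \<nu> by (rule iid_walk_nu)
  have [measurable]: "E\<inverse> \<in> sets (borel \<Otimes>\<^sub>M borel)"
    using E by (rule converse_measurable)
  have [measurable]: "- E \<in> sets (borel \<Otimes>\<^sub>M borel)"
    using sets.compl_sets[OF E] by (simp add: space_pair_measure Compl_eq_Diff_UNIV)
  define \<rho> where "\<rho> = edge_step \<nu> (E\<inverse>) (\<lambda>_. 1)"
  have \<rho>_meas [measurable]: "\<rho> \<in> borel_measurable borel"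
    unfolding \<rho>_def by measurable
  have \<rho>_D: "d x = \<rho> x" if "x \<in> D" for x
    using dens[OF that] reversed_step_probability[OF E, of x] by (simp add: \<rho>_def)
  have \<rho>_outside: "\<rho> x = 0" if "x \<in> G - D" for x
    using outside[OF that] reversed_step_probability[OF E, of x] by (simp add: \<rho>_def)
  have D_lam: "D \<in> sets lam"
    using \<open>D \<subseteq> G\<close> by (auto simp: sets_haar sets_restrict_space)
  have space_D: "space (restrict_space lam D) = D"
    using \<open>D \<subseteq> G\<close> by (auto simp: space_restrict_space space_haar)
  have restr_meas: "f \<in> borel_measurable (restrict_space lam D)" if "f \<in> borel_measurable borel"
    for f :: "'a \<Rightarrow> ennreal"
    using measurable_compose[OF haar_embedding_measurable that] by (rule measurable_restrict_space1)
  \<comment> \<open>\<open>d\<close> is prescribed only on \<open>D\<close>; there it agrees with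
    the measurable \<open>\<rho>\<close> and inherits its measurability.\<close>
  have density: "density (restrict_space lam D) d = density (restrict_space lam D) \<rho>"
  proof (rule density_cong)
    show "\<rho> \<in> borel_measurable (restrict_space lam D)"
      by (rule restr_meas) measurable
    then show "d \<in> borel_measurable (restrict_space lam D)"
      by (subst measurable_cong[of _ d \<rho>]) (auto simp: space_D \<rho>_D)
  qed (auto simp: space_D \<rho>_D intro!: AE_I2)
  have integral: "(\<integral>\<^sup>+ x. f x \<partial>density (restrict_space lam D) \<rho>) = (\<integral>\<^sup>+ x. \<rho> x * f x \<partial>L)"
    if [measurable]: "f \<in> borel_measurable borel" for f
  proof -
    have "(\<integral>\<^sup>+ x. f x \<partial>density (restrict_space lam D) \<rho>) =
        (\<integral>\<^sup>+ x. \<rho> x * f x \<partial>restrict_space lam D)"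
      by (rule nn_integral_density) (auto intro: restr_meas that)
    also have "\<dots> = (\<integral>\<^sup>+ x. \<rho> x * f x * indicator D x \<partial>lam)"
      by (rule nn_integral_restrict_space) (use D_lam space_haar in auto)
    also have "\<dots> = (\<integral>\<^sup>+ x. \<rho> x * f x \<partial>lam)"
      using \<rho>_outside by (intro nn_integral_cong) (auto simp: space_haar indicator_def)
    also have "\<dots> = (\<integral>\<^sup>+ x. \<rho> x * f x \<partial>L)"
      by (subst nn_integral_distr) auto
    finally show ?thesis .
  qed
  have hit_nu: "AE x in L. AE \<omega> in PiM UNIV (\<lambda>_::nat. \<nu>).
      \<exists>n. (walk_path x \<omega> (Suc n), walk_path x \<omega> n) \<in> E"
  proof -
    have "AE \<omega> in PiM UNIV (\<lambda>_::nat. \<nu>). \<exists>n. (walk_path x \<omega> (Suc n), walk_path x \<omega> n) \<in> E"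
      if "x \<in> G" for x
    proof -
      have [measurable]: "(\<lambda>\<omega>. walk_path x \<omega> n) \<in> borel_measurable (PiM UNIV (\<lambda>_::nat. borel))" for n
        unfolding walk_path_def by measurable
      show ?thesis
        unfolding distr_increments_nu[symmetric]
        using hit[OF that] by (subst AE_distr_iff) measurable
    qed
    moreover have "AE x in L. x \<in> G"
      by (subst AE_distr_iff) (auto simp: space_haar intro!: AE_I2)
    ultimately show ?thesis
      by auto
  qed
  have sets: "sets (density (restrict_space lam D) d) = sets (restrict_space borel D)"
  proof -
    have "sets (restrict_space lam D) = sets (restrict_space (restrict_space borel G) D)"
      using sets_haar by (rule sets_restrict_space_cong)
    also have "\<dots> = sets (restrict_space borel D)"
      using \<open>D \<subseteq> G\<close> by (subst sets_restrict_restrict_space) (simp add: Int_absorb1)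
    finally show ?thesis by simp
  qed
  show ?thesis
    unfolding invariant_on_def
  proof (intro conjI ballI impI sets)
    fix C :: "'a set" assume C [measurable]: "C \<in> sets borel" and "C \<subseteq> D"
    have "(\<integral>\<^sup>+ x. event_kernel M X Q x C \<partial>density (restrict_space lam D) d) =
        (\<integral>\<^sup>+ x. \<rho> x * emeasure mu.S {\<omega>. \<exists>n. \<omega> \<in> first_passage E C x n} \<partial>L)"
      \<comment> \<open>Measurability of the kernel in its starting point is read off from its
        series.\<close>
      unfolding density event_kernel_eq[OF E C Q]
      by (rule integral) (unfold mu.emeasure_ex_first_passage[OF E C], measurable)
    also have "\<dots> = (\<integral>\<^sup>+ x. \<rho> x * indicator C x \<partial>L)"
      unfolding \<rho>_def
      by (rule nn_integral_edge_balance[OF iid_walk_mu sigma_finite_haar_embedding _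
            AE_translate_haar_embedding E C refl hit_nu]) simp
    also have "\<dots> = (\<integral>\<^sup>+ x. indicator C x \<partial>density (restrict_space lam D) d)"
      unfolding density by (rule integral[symmetric]) measurable
    also have "\<dots> = emeasure (density (restrict_space lam D) d) C"
    proof (rule nn_integral_indicator)
      show "C \<in> sets (density (restrict_space lam D) d)"
        unfolding sets sets_restrict_space using \<open>C \<subseteq> D\<close> C by (intro image_eqI[of _ _ C]) blast+
    qed
    finally show "(\<integral>\<^sup>+ x. event_kernel M X Q x C \<partial>density (restrict_space lam D) d) =
        emeasure (density (restrict_space lam D) d) C" .
  qed
qed

end

end

section \<open>Entrances and overshoots\<close>

text \<open>A discrete intermediate value argument by induction from \<open>m\<close> to
  \<open>n\<close>. For the reflected walk, leaving a set means entering it along a reversed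
  edge.\<close>

lemma last_exit:
  fixes R :: "nat \<Rightarrow> 'a"
  assumes "P (R m)" "\<not> P (R n)" "m \<le> n"
  shows "\<exists>k. P (R k) \<and> \<not> P (R (Suc k))"
  using assms(3,1,2) by (induction rule: dec_induct) auto

lemma invariant_on_entrance:
  fixes X :: "nat \<Rightarrow> 'w \<Rightarrow> 'a::euclidean_space"
  assumes walk: "random_walk M X" and haar: "haar_measure_on (state_space M X) lam"
    and B [measurable]: "B \<in> sets borel"
    and dens: "\<And>x. x \<in> state_space M X \<inter> B \<Longrightarrow> d x = emeasure M {\<omega> \<in> space M. x - X 1 \<omega> \<notin> B}"
    and visits: "AE \<omega> in M. \<forall>x m. (\<exists>n\<ge>m. walk_path x (\<lambda>i. - X (Suc i) \<omega>) n \<in> B) \<and>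
      (\<exists>n\<ge>m. walk_path x (\<lambda>i. - X (Suc i) \<omega>) n \<notin> B)"
  shows "invariant_on (state_space M X \<inter> B) (entrance_kernel M X B)
    (density (restrict_space lam (state_space M X \<inter> B)) d)"
proof -
  interpret random_walk_on M X
    by unfold_locales (rule walk)
  let ?E = "(G - B) \<times> (G \<inter> B)"
  show ?thesis
    unfolding entrance_kernel_def
  proof (rule invariant_on_edges[OF haar, where E = ?E])
    fix x assume x: "x \<in> G \<inter> B"
    \<comment> \<open>Almost surely \<open>x - X 1 \<omega>\<close> stays in \<open>G\<close>, so
      missing \<open>B\<close> means lying in \<open>G - B\<close>.\<close>
    have "AE \<omega> in M. x - X 1 \<omega> \<notin> B \<longleftrightarrow> (x - X 1 \<omega>, x) \<in> ?E"
      using AE_X_in_G[of 0] by eventually_elim (use x diff_in_G in auto)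
    then have "emeasure M {\<omega> \<in> space M. x - X 1 \<omega> \<notin> B} =
        emeasure M {\<omega> \<in> space M. (x - X 1 \<omega>, x) \<in> ?E}"
      by (intro emeasure_eq_AE) auto
    then show "d x = emeasure M {\<omega> \<in> space M. (x - X 1 \<omega>, x) \<in> ?E}"
      by (simp only: dens[OF x])
  next
    fix x assume x: "x \<in> G"
    have "AE \<omega> in M. \<forall>i. X (Suc i) \<omega> \<in> G"
      using AE_X_in_G by (simp add: AE_all_countable)
    with visits show "AE \<omega> in M. \<exists>n. (walk_path x (\<lambda>i. - X (Suc i) \<omega>) (Suc n),
        walk_path x (\<lambda>i. - X (Suc i) \<omega>) n) \<in> ?E"
    proof eventually_elim
      case (elim \<omega>)
      define R where "R = walk_path x (\<lambda>i. - X (Suc i) \<omega>)"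
      have "R n \<in> G" for n
        unfolding R_def using x elim by (intro reflected_walk_in_G) auto
      moreover obtain m n where "R m \<in> B" "m \<le> n" "R n \<notin> B"
        using elim unfolding R_def by blast
      then have "\<exists>k. R k \<in> B \<and> R (Suc k) \<notin> B"
        by (intro last_exit[of "\<lambda>y. y \<in> B"])
      ultimately show ?case
        unfolding R_def by blast
    qed
  qed auto
qed

text \<open>\<open>dichotomy\<close> encodes dimension one. The edges are the pairs on different
  sides of the origin, and \<open>D\<close> is all of \<open>G\<close>.\<close>

lemma invariant_on_overshoots:
  fixes X :: "nat \<Rightarrow> 'w \<Rightarrow> 'a::ordered_euclidean_space"
  assumes walk: "random_walk M X" and haar: "haar_measure_on (state_space M X) lam"
    and dichotomy: "\<And>y::'a. y <e 0 \<longleftrightarrow> \<not> 0 \<le> y"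
    and dens: "\<And>x. d x = emeasure M {\<omega> \<in> space M. (x - X 1 \<omega> <e 0) \<noteq> (x <e 0)}"
    and visits: "AE \<omega> in M. \<forall>x m. (\<exists>n\<ge>m. 0 <e walk_path x (\<lambda>i. - X (Suc i) \<omega>) n) \<and>
      (\<exists>n\<ge>m. walk_path x (\<lambda>i. - X (Suc i) \<omega>) n <e 0)"
  shows "invariant_on (state_space M X) (overshoot_kernel M X) (density lam d)"
proof -
  interpret random_walk_on M X
    by unfold_locales (rule walk)
  let ?E = "{p. (fst p <e (0::'a)) \<noteq> (snd p <e 0)}"
  have "restrict_space lam (space lam) = lam"
    by (intro measure_eqI)
      (auto simp: sets_restrict_space_iff emeasure_restrict_space dest: subsetD[OF sets.sets_into_space])
  then have "restrict_space lam G = lam"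
    unfolding space_haar[OF haar] .
  moreover have "invariant_on G (overshoot_kernel M X) (density (restrict_space lam G) d)"
    unfolding overshoot_kernel_def
  proof (rule invariant_on_edges[OF haar, where E = ?E])
    have "{p \<in> space (borel \<Otimes>\<^sub>M borel). (fst p <e (0::'a)) \<noteq> (snd p <e 0)} \<in> sets (borel \<Otimes>\<^sub>M borel)"
      unfolding eucl_less_def by measurable
    then show "?E \<in> sets (borel \<Otimes>\<^sub>M borel)"
      by (simp add: space_pair_measure)
  next
    show "(s (k - 1) <e 0 \<and> 0 \<le> s k \<or> 0 \<le> s (k - 1) \<and> s k <e 0) \<longleftrightarrow> (s (k - 1), s k) \<in> ?E"
      for s :: "nat \<Rightarrow> 'a" and k
      using dichotomy by auto
  next
    fix x assume x: "x \<in> G"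
    show "AE \<omega> in M. \<exists>n. (walk_path x (\<lambda>i. - X (Suc i) \<omega>) (Suc n),
        walk_path x (\<lambda>i. - X (Suc i) \<omega>) n) \<in> ?E"
      using visits
    proof eventually_elim
      case (elim \<omega>)
      define R where "R = walk_path x (\<lambda>i. - X (Suc i) \<omega>)"
      obtain m n where "R m <e 0" "m \<le> n" "0 <e R n"
        using elim unfolding R_def by blast
      moreover have "\<not> R n <e 0"
        using \<open>0 <e R n\<close> SOME_Basis by (force simp: eucl_less_def)
      \<comment> \<open>The edge set is symmetric, so an exit from the negative side yields a
        reversed edge of it.\<close>
      ultimately have "\<exists>k. R k <e 0 \<and> \<not> R (Suc k) <e 0"
        by (intro last_exit[of "\<lambda>y. y <e 0"])
      then show ?case
        unfolding R_def by auto
    qed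
  qed (auto simp: dens)
  ultimately show ?thesis
    by simp
qed

lemma eucl_less_zero_iff_not_nonneg:
  fixes y :: "'a::ordered_euclidean_space"
  assumes "DIM('a) = 1"
  shows "y <e 0 \<longleftrightarrow> \<not> 0 \<le> y"
proof -
  obtain b where b: "Basis = {b::'a}"
    using assms by (auto simp: card_1_singleton_iff)
  then show ?thesis
    unfolding eucl_less_def eucl_le[where 'a = 'a] b by auto
qed

theorem corollary5p1:
  fixes M :: "'w measure"
    and X :: "nat \<Rightarrow> 'w \<Rightarrow> 'a::ordered_euclidean_space"
    and lam :: "'a measure"
  assumes "random_walk M X"
    and "haar_measure_on (state_space M X) lam"
    and "\<P>(s in walk_law M X 0. event_time (\<lambda>n. s n \<in> {y. 0 <e y}) 1 < \<infinity>) = 1"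
    and "\<P>(s in walk_law M X 0. event_time (\<lambda>n. s n \<in> {y. y <e 0}) 1 < \<infinity>) = 1"
  shows "invariant_on (state_space M X \<inter> {y. 0 \<le> y})
           (entrance_kernel M X {y. 0 \<le> y})
           (density (restrict_space lam (state_space M X \<inter> {y. 0 \<le> y}))
             (\<lambda>x. ennreal (1 - \<P>(\<omega> in M. X 1 \<omega> \<le> x))))
       \<and> invariant_on (state_space M X \<inter> {y. y <e 0})
           (entrance_kernel M X {y. y <e 0})
           (density (restrict_space lam (state_space M X \<inter> {y. y <e 0}))
             (\<lambda>x. ennreal (1 - \<P>(\<omega> in M. x <e X 1 \<omega>))))
       \<and> (DIM('a) = 1 \<longrightarrow>
           invariant_on (state_space M X) (overshoot_kernel M X)
             (density lam
               (\<lambda>x. ennreal (indicator {y. 0 \<le> y} x * \<P>(\<omega> in M. x <e X 1 \<omega>)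
                           + indicator {y. y <e 0} x * \<P>(\<omega> in M. X 1 \<omega> \<le> x)))))"
proof (intro conjI impI)
  interpret random_walk_on M X
    by unfold_locales (rule assms)
  have [measurable]: "Measurable.pred M (\<lambda>\<omega>. X 1 \<omega> \<le> x)" for x
    unfolding eucl_le[where 'a = 'a] by measurable
  have [measurable]: "Measurable.pred M (\<lambda>\<omega>. x <e X 1 \<omega>)" for x
    unfolding eucl_less_def by measurable
  have nonneg_iff: "0 \<le> x - y \<longleftrightarrow> y \<le> x" and neg_iff: "x - y <e 0 \<longleftrightarrow> x <e y" for x y :: 'a
    by (simp_all add: eucl_le[where 'a = 'a] eucl_less_def inner_diff_left)
  \<comment> \<open>A basis vector exists, so the orthants are disjoint in any dimension; a visit to
    the opposite orthant is thus an exit from the given one.\<close>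
  have disjoint: "\<not> (0 <e y \<and> y <e 0)" "\<not> (0 \<le> y \<and> y <e 0)" for y :: 'a
    using SOME_Basis[where 'a = 'a] by (force simp: eucl_less_def eucl_le[where 'a = 'a])+
  have pos_nonneg: "0 <e y \<Longrightarrow> 0 \<le> y" for y :: 'a
    by (auto simp: eucl_less_def eucl_le[where 'a = 'a] intro: less_imp_le)
  note visits = AE_reflected_walk_oscillates[OF assms(3,4)]
  have [measurable]: "{y. (0::'a) \<le> y} \<in> sets borel"
    using closed_eucl_atLeast[of "0::'a"] by (simp add: atLeast_def)
  show "invariant_on (G \<inter> {y. 0 \<le> y}) (entrance_kernel M X {y. 0 \<le> y})
      (density (restrict_space lam (G \<inter> {y. 0 \<le> y})) (\<lambda>x. ennreal (1 - \<P>(\<omega> in M. X 1 \<omega> \<le> x))))"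
  proof (rule invariant_on_entrance[OF assms(1,2)])
    show "ennreal (1 - \<P>(\<omega> in M. X 1 \<omega> \<le> x)) = emeasure M {\<omega> \<in> space M. x - X 1 \<omega> \<notin> {y. 0 \<le> y}}" for x
      unfolding emeasure_eq_measure mem_Collect_eq nonneg_iff by (subst prob_neg) measurable
    show "AE \<omega> in M. \<forall>x m. (\<exists>n\<ge>m. walk_path x (\<lambda>i. - X (Suc i) \<omega>) n \<in> {y. 0 \<le> y}) \<and>
        (\<exists>n\<ge>m. walk_path x (\<lambda>i. - X (Suc i) \<omega>) n \<notin> {y. 0 \<le> y})"
      using visits unfolding mem_Collect_eq by eventually_elim (meson pos_nonneg disjoint)
  qed measurable
  show "invariant_on (G \<inter> {y. y <e 0}) (entrance_kernel M X {y. y <e 0})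
      (density (restrict_space lam (G \<inter> {y. y <e 0})) (\<lambda>x. ennreal (1 - \<P>(\<omega> in M. x <e X 1 \<omega>))))"
  proof (rule invariant_on_entrance[OF assms(1,2)])
    show "ennreal (1 - \<P>(\<omega> in M. x <e X 1 \<omega>)) = emeasure M {\<omega> \<in> space M. x - X 1 \<omega> \<notin> {y. y <e 0}}" for x
      unfolding emeasure_eq_measure mem_Collect_eq neg_iff by (subst prob_neg) measurable
    show "AE \<omega> in M. \<forall>x m. (\<exists>n\<ge>m. walk_path x (\<lambda>i. - X (Suc i) \<omega>) n \<in> {y. y <e 0}) \<and>
        (\<exists>n\<ge>m. walk_path x (\<lambda>i. - X (Suc i) \<omega>) n \<notin> {y. y <e 0})"
      using visits unfolding mem_Collect_eq by eventually_elim (meson disjoint)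
  qed simp
  show "invariant_on G (overshoot_kernel M X) (density lam
      (\<lambda>x. ennreal (indicator {y. 0 \<le> y} x * \<P>(\<omega> in M. x <e X 1 \<omega>)
        + indicator {y. y <e 0} x * \<P>(\<omega> in M. X 1 \<omega> \<le> x))))"
    if "DIM('a) = 1"
  proof (rule invariant_on_overshoots[OF assms(1,2) _ _ visits])
    show dichotomy: "y <e 0 \<longleftrightarrow> \<not> 0 \<le> y" for y :: 'a
      using that by (rule eucl_less_zero_iff_not_nonneg)
    \<comment> \<open>For \<open>0 \<le> x\<close> a change of side means
      \<open>x - X 1 \<omega> <e 0\<close>, that is \<open>x <e X 1 \<omega>\<close>; for negative
      \<open>x\<close> it means \<open>X 1 \<omega> \<le> x\<close>.\<close>
    show "ennreal (indicator {y. 0 \<le> y} x * \<P>(\<omega> in M. x <e X 1 \<omega>)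
        + indicator {y. y <e 0} x * \<P>(\<omega> in M. X 1 \<omega> \<le> x)) =
      emeasure M {\<omega> \<in> space M. (x - X 1 \<omega> <e 0) \<noteq> (x <e 0)}" for x
    proof (cases "0 \<le> x")
      case True
      then show ?thesis
        using dichotomy[of x] by (simp add: emeasure_eq_measure neg_iff)
    next
      case False
      then show ?thesis
        using dichotomy[of x] by (simp add: emeasure_eq_measure dichotomy[of "x - _"] nonneg_iff)
    qed
  qed
qed

end
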